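(* Consider solving $Ax=0$ using Anderson acceleration AA(1) applied to the linear fixed-point iteration function $q(x)=Mx$ with $M=I-A$ and nonzero initial guess $x_0\in\mathbb{R}^n$. Let $\beta_k(x_0)$ denote the AA(1) coefficients and $p_k(\lambda,x_0)$ the AA(1) residual polynomials generated from the initial guess $x_0$. Then for any nonzero scalar $\alpha\in\mathbb{R}$, $$\beta_k(x_0)=\beta_k(\alpha x_0)\quad\text{for all }k\ge1,$$ and, therefore, $$p_k(\lambda,x_0)=p_k(\lambda,\alpha x_0)\quad\text{for all }k\ge 0.$$
   Context: Setting: $A\in\mathbb{R}^{n\times n}$ is nonsingular, $M=I-A\neq0$, $q(x)=Mx$. $\|\cdot\|$ is the 2-norm. The residuals are $r_k=x_k-q(x_k)=Ax_k$. AA(1): given $x_0\in\mathbb{R}^n$, set $x_1=q(x_0)$ and for $k\ge1$ $$x_{k+1}=(1+\beta_k)q(x_k)-\beta_kq(x_{k-1}),\qquad \beta_k=\frac{-r_k^T(r_k-r_{k-1})}{\|r_k-r_{k-1}\|^2}\ \text{ if } r_k\ne r_{k-1},$$ and $\beta_k=0$ if $r_k=r_{k-1}$. The AA(1) residual polynomials, which satisfy $r_k=p_k(M)r_0$, are defined by $p_0(\lambda)=1$, $p_1(\lambda)=\lambda$, $p_{k+1}(\lambda)=(1+\beta_k)\lambda p_k(\lambda)-\beta_k\lambda p_{k-1}(\lambda)$ for $k\ge1$; they depend on $x_0$ through the $\beta_k$. *)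

theory Defs
  imports "HOL-Analysis.Analysis" "HOL-Computational_Algebra.Polynomial"
begin

definition fp_residual :: "('a::real_inner \<Rightarrow> 'a) \<Rightarrow> 'a \<Rightarrow> 'a" where
  "fp_residual q x = x - q x"

text \<open>The AA(1) coefficient determined by the current iterate \<open>x\<close> and the previous iterate \<open>y\<close>.\<close>

definition aa1_coeff :: "('a::real_inner \<Rightarrow> 'a) \<Rightarrow> 'a \<Rightarrow> 'a \<Rightarrow> real" where
  "aa1_coeff q x y =
     (let r = fp_residual q x; s = fp_residual q y in
      if r \<noteq> s then - (r \<bullet> (r - s)) / (norm (r - s))\<^sup>2 else 0)"

fun aa1_iter :: "('a::real_inner \<Rightarrow> 'a) \<Rightarrow> 'a \<Rightarrow> nat \<Rightarrow> 'a" where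
  "aa1_iter q x0 0 = x0"
| "aa1_iter q x0 (Suc 0) = q x0"
| "aa1_iter q x0 (Suc (Suc k)) =
     (let x = aa1_iter q x0 (Suc k); y = aa1_iter q x0 k; b = aa1_coeff q x y in
      (1 + b) *\<^sub>R q x - b *\<^sub>R q y)"

text \<open>The sequence of coefficients is meaningful for \<open>k \<ge> 1\<close> only; the value at \<open>k = 0\<close> is
  a junk value.\<close>

definition aa1_beta :: "('a::real_inner \<Rightarrow> 'a) \<Rightarrow> 'a \<Rightarrow> nat \<Rightarrow> real" where
  "aa1_beta q x0 k = aa1_coeff q (aa1_iter q x0 k) (aa1_iter q x0 (k - 1))"

lemma aa1_iter_rec:
  assumes "k \<ge> 1"
  shows "aa1_iter q x0 (k + 1) =
           (1 + aa1_beta q x0 k) *\<^sub>R q (aa1_iter q x0 k)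
             - aa1_beta q x0 k *\<^sub>R q (aa1_iter q x0 (k - 1))"
  using assms by (cases k) (simp_all add: aa1_beta_def Let_def)

text \<open>Here \<open>[:0, 1:]\<close> is the polynomial variable \<open>\<lambda>\<close>.\<close>

fun aa1_res_poly :: "('a::real_inner \<Rightarrow> 'a) \<Rightarrow> 'a \<Rightarrow> nat \<Rightarrow> real poly" where
  "aa1_res_poly q x0 0 = 1"
| "aa1_res_poly q x0 (Suc 0) = [:0, 1:]"
| "aa1_res_poly q x0 (Suc (Suc k)) =
     smult (1 + aa1_beta q x0 (Suc k)) ([:0, 1:] * aa1_res_poly q x0 (Suc k))
       - smult (aa1_beta q x0 (Suc k)) ([:0, 1:] * aa1_res_poly q x0 k)"

end

theory Submission
  imports Defs
begin

text \<open>
  For linear \<open>q\<close> the residual is linear in the iterate, so the coefficient is a quotient of two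
  quadratic forms in the pair (current iterate, previous iterate), hence homogeneous of degree
  \<open>0\<close> (\<open>aa1_coeff_scaleR\<close>). The update is thus a linear combination whose weights do not notice
  a common scaling of the two iterates, and by induction the whole sequence of iterates scales
  with the initial guess (\<open>aa1_iter_scaleR\<close>). The coefficients are therefore unchanged, and so
  are the residual polynomials, whose recurrence sees the initial guess only through them.
\<close>

lemma fp_residual_scaleR:
  assumes "linear q"
  shows "fp_residual q (c *\<^sub>R x) = c *\<^sub>R fp_residual q x"
  using assms by (simp add: fp_residual_def linear_scale scaleR_diff_right)

text \<open>
  Both numerator and denominator pick up the factor \<open>c\<^sup>2\<close>. The condition \<open>c \<noteq> 0\<close> allows this
  factor to cancel and keeps the case distinction on equal residuals intact.
\<close>

lemma aa1_coeff_scaleR: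
  assumes "linear q" and "c \<noteq> 0"
  shows "aa1_coeff q (c *\<^sub>R x) (c *\<^sub>R y) = aa1_coeff q x y"
proof -
  define r s where "r = fp_residual q x" and "s = fp_residual q y"
  have "- ((c *\<^sub>R r) \<bullet> (c *\<^sub>R r - c *\<^sub>R s)) / (norm (c *\<^sub>R r - c *\<^sub>R s))\<^sup>2
      = (c\<^sup>2 * - (r \<bullet> (r - s))) / (c\<^sup>2 * (norm (r - s))\<^sup>2)"
    by (simp add: scaleR_diff_right [symmetric] power_mult_distrib)
      (simp add: power2_eq_square)
  also have "\<dots> = - (r \<bullet> (r - s)) / (norm (r - s))\<^sup>2"
    using \<open>c \<noteq> 0\<close> by simp
  finally show ?thesis
    using assms by (simp add: aa1_coeff_def Let_def fp_residual_scaleR r_def s_def)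
qed

lemma aa1_iter_scaleR:
  assumes "linear q" and "c \<noteq> 0"
  shows "aa1_iter q (c *\<^sub>R x0) k = c *\<^sub>R aa1_iter q x0 k"
  using assms
  by (induction q x0 k rule: aa1_iter.induct)
    (simp_all add: Let_def aa1_coeff_scaleR linear_scale scaleR_diff_right mult.commute)

lemma aa1_beta_scaleR:
  assumes "linear q" and "c \<noteq> 0"
  shows "aa1_beta q (c *\<^sub>R x0) k = aa1_beta q x0 k"
  using assms by (simp add: aa1_beta_def aa1_iter_scaleR aa1_coeff_scaleR)

lemma aa1_res_poly_scaleR:
  assumes "linear q" and "c \<noteq> 0"
  shows "aa1_res_poly q (c *\<^sub>R x0) k = aa1_res_poly q x0 k"
  using assms by (induction q x0 k rule: aa1_res_poly.induct) (simp_all add: aa1_beta_scaleR)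

theorem proposition3p9:
  fixes A M :: "real ^ 'n ^ 'n"
    and q :: "real ^ 'n \<Rightarrow> real ^ 'n"
    and x0 :: "real ^ 'n"
    and \<alpha> :: real
  assumes "invertible A"
    and "M = mat 1 - A"
    and "M \<noteq> 0"
    and "q = (\<lambda>x. M *v x)"
    and "x0 \<noteq> 0"
    and "\<alpha> \<noteq> 0"
  shows "(\<forall>k\<ge>1. aa1_beta q x0 k = aa1_beta q (\<alpha> *\<^sub>R x0) k) \<and>
         (\<forall>k. aa1_res_poly q x0 k = aa1_res_poly q (\<alpha> *\<^sub>R x0) k)"
proof -
  have "linear q"
    using \<open>q = (\<lambda>x. M *v x)\<close> by simp
  then show ?thesis
    using \<open>\<alpha> \<noteq> 0\<close> by (simp add: aa1_beta_scaleR aa1_res_poly_scaleR)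
qed

end
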